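(* Let $n\ge k\ge 0$ be integers and $a,b,c$ real numbers. At all real $(x,y)$ with $x\ne 1$ the following hold: $$\begin{aligned} (2k+b+c+1)\tfrac{\partial}{\partial x}P_{n,k}^{(a,b,c)}&=(n+k+a+b+c+2)(k+b+c+1)P_{n-1,k}^{(a+1,b,c+1)}+(k+b)(n+k+b+c+1)P_{n-1,k-1}^{(a+1,b,c+1)},\\ \tfrac{\partial}{\partial y}P_{n,k}^{(a,b,c)}&=(k+b+c+1)P_{n-1,k-1}^{(a,b+1,c+1)},\\ (2k+b+c+1)\tfrac{\partial}{\partial z}P_{n,k}^{(a,b,c)}&=-(n+k+a+b+c+2)(k+b+c+1)P_{n-1,k}^{(a+1,b+1,c)}+(k+c)(n+k+b+c+1)P_{n-1,k-1}^{(a+1,b+1,c)}, \end{aligned}$$ where $\frac{\partial}{\partial z}$ denotes the operator $\frac{\partial}{\partial y}-\frac{\partial}{\partial x}$.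
   Context: Jacobi polynomials: for an integer $m\ge 0$ and real $\alpha,\beta$, $P_m^{(\alpha,\beta)}(x)=\sum_{s=0}^m\binom{m+\alpha}{m-s}\binom{m+\beta}{s}\left(\frac{x-1}{2}\right)^s\left(\frac{x+1}{2}\right)^{m-s}$ (generalized binomial coefficients), and $P_{-1}^{(\alpha,\beta)}=0$. Shifted Jacobi polynomials: $\tilde P_m^{(\alpha,\beta)}(x)=P_m^{(\alpha,\beta)}(2x-1)$. For real $a,b,c$ and integers $n,k$, at points with $x\ne1$, $$P_{n,k}^{(a,b,c)}(x,y)=\tilde P_{n-k}^{(2k+b+c+1,a)}(x)\,(1-x)^k\,\tilde P_k^{(c,b)}\!\left(\tfrac{y}{1-x}\right)\qquad (n\ge k\ge 0),$$ and $P_{n,k}^{(a,b,c)}=0$ whenever $k=-1$ or $n-k=-1$. *)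

theory Defs
  imports Complex_Main "HOL-Analysis.Derivative"
begin

text \<open>The degree is an integer so that index \<open>-1\<close> is available; the polynomial is zero there.\<close>

definition jacobi_poly :: "int \<Rightarrow> real \<Rightarrow> real \<Rightarrow> real \<Rightarrow> real" where
  "jacobi_poly m \<alpha> \<beta> x =
     (if m < 0 then 0
      else (\<Sum>s = 0..nat m.
              ((of_int m + \<alpha>) gchoose (nat m - s)) * ((of_int m + \<beta>) gchoose s)
              * ((x - 1) / 2) ^ s * ((x + 1) / 2) ^ (nat m - s)))"

definition shifted_jacobi_poly :: "int \<Rightarrow> real \<Rightarrow> real \<Rightarrow> real \<Rightarrow> real" where
  "shifted_jacobi_poly m \<alpha> \<beta> x = jacobi_poly m \<alpha> \<beta> (2 * x - 1)"

text \<open>This formula is meaningful only for \<open>x \<noteq> 1\<close>: at \<open>x = 1\<close> the convention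
  \<open>y / 0 = 0\<close> need not give the value of the polynomial extension.\<close>

definition triangle_jacobi ::
    "int \<Rightarrow> int \<Rightarrow> real \<Rightarrow> real \<Rightarrow> real \<Rightarrow> real \<Rightarrow> real \<Rightarrow> real" where
  "triangle_jacobi n k a b c x y =
     (if k < 0 \<or> n - k < 0 then 0
      else shifted_jacobi_poly (n - k) (2 * of_int k + b + c + 1) a x
           * (1 - x) ^ nat k * shifted_jacobi_poly k c b (y / (1 - x)))"

definition partial_x :: "(real \<Rightarrow> real \<Rightarrow> real) \<Rightarrow> real \<Rightarrow> real \<Rightarrow> real" where
  "partial_x f x y = deriv (\<lambda>t. f t y) x"

definition partial_y :: "(real \<Rightarrow> real \<Rightarrow> real) \<Rightarrow> real \<Rightarrow> real \<Rightarrow> real" where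
  "partial_y f x y = deriv (\<lambda>t. f x t) y"

definition partial_z :: "(real \<Rightarrow> real \<Rightarrow> real) \<Rightarrow> real \<Rightarrow> real \<Rightarrow> real" where
  "partial_z f x y = partial_y f x y - partial_x f x y"

end

theory Submission
  imports Defs "HOL-Computational_Algebra.Formal_Power_Series"
begin

text \<open>
  Expanded in powers of \<open>x - 1\<close>, the shifted Jacobi polynomial of degree \<open>m\<close> has the coefficients
  \<open>(m + \<alpha> gchoose m - s) * (m + \<alpha> + \<beta> + s gchoose s)\<close>, by trinomial revision and Vandermonde's
  identity. In this basis the derivative formula and the relations that raise or lower a parameter
  hold coefficient by coefficient, without dividing by anything that could vanish. Writing a
  partial derivative of the triangle polynomial by the product and chain rules, each of the three
  formulas is a linear combination of these one-variable relations, taken at \<open>x\<close> and at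
  \<open>y / (1 - x)\<close>.
\<close>

section \<open>Expansion in powers of x - 1\<close>

lemma real_Suc_times_gbinomial_Suc:
  "real (Suc i) * (a gchoose Suc i) = (a - real i) * (a gchoose i)"
  using gbinomial_mult_1[of a i] by (simp add: algebra_simps)

text \<open>The guard makes the coefficients beyond the degree vanish, and all of them when m is
  negative, where \<open>nat (m - int s)\<close> would be cut off at 0. Relations between degrees m
  and m - 1 can then be stated for every integer m.\<close>

definition shifted_jacobi_coeff :: "int \<Rightarrow> real \<Rightarrow> real \<Rightarrow> nat \<Rightarrow> real" where
  "shifted_jacobi_coeff m \<alpha> \<beta> s =
     (if int s \<le> m
      then (of_int m + \<alpha> gchoose nat (m - int s)) * (of_int m + \<alpha> + \<beta> + real s gchoose s)
      else 0)"

lemma shifted_jacobi_coeff_eq_0 [simp]: "m < int s \<Longrightarrow> shifted_jacobi_coeff m \<alpha> \<beta> s = 0"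
  by (simp add: shifted_jacobi_coeff_def)

text \<open>Puts coefficients of neighbouring degrees and parameters over common top entries
  \<open>A\<close> and \<open>B\<close>, so that relations among them reduce to Pascal's rule and
  absorption.\<close>

lemma shifted_jacobi_coeff_eqI:
  assumes "m = int s + int j" "A = of_int m + \<alpha>" "B = of_int m + \<alpha> + \<beta> + real s"
  shows "shifted_jacobi_coeff m \<alpha> \<beta> s = (A gchoose j) * (B gchoose s)"
  using assms by (simp add: shifted_jacobi_coeff_def)

text \<open>In the relations below, m < s makes every coefficient zero, m = s kills those of degree
  m - 1 or index s + 1, and m > s is the generic case.\<close>

lemma le_int_cases:
  obtains "m < int s" | "m = int s" | i where "m = int s + int (Suc i)"
proof (cases "m \<le> int s")
  case True
  then show ?thesis using that(1,2) by fastforce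
next
  case False
  then have "m = int s + int (Suc (nat (m - int s - 1)))" by simp
  then show ?thesis by (rule that(3))
qed

text \<open>Any bound \<open>K\<close> above the degree is allowed, so that degrees m and m - 1 can
  be compared over one index range. After the shift the two linear factors are u and u + 1; the
  powers of u + 1 are expanded and the terms in u^r collected.\<close>

lemma shifted_jacobi_poly_expansion:
  assumes "m < int K"
  shows "shifted_jacobi_poly m \<alpha> \<beta> x = (\<Sum>s<K. shifted_jacobi_coeff m \<alpha> \<beta> s * (x - 1) ^ s)"
proof (cases "m < 0")
  case True
  then show ?thesis by (simp add: shifted_jacobi_poly_def jacobi_poly_def)
next
  case False
  then obtain p where m: "m = int p" by (metis nonneg_int_cases not_less)
  define u where "u = x - 1"
  have "shifted_jacobi_poly m \<alpha> \<beta> x =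
      (\<Sum>s\<le>p. (p + \<alpha> gchoose (p - s)) * (p + \<beta> gchoose s) * u ^ s * (u + 1) ^ (p - s))"
    by (simp add: shifted_jacobi_poly_def jacobi_poly_def m u_def atLeast0AtMost diff_divide_distrib)
  also have "\<dots> = (\<Sum>s\<le>p. \<Sum>j\<le>p - s. (p + \<alpha> gchoose (p - s)) * (p + \<beta> gchoose s)
      * real ((p - s) choose j) * u ^ (s + j))"
    by (simp add: binomial_ring sum_distrib_left power_add mult_ac)
  also have "\<dots> = (\<Sum>s\<le>p. \<Sum>r = s..p. (p + \<alpha> gchoose (p - s)) * (p + \<beta> gchoose s)
      * real ((p - s) choose (r - s)) * u ^ r)"
  proof (rule sum.cong, rule refl)
    fix s assume "s \<in> {..p}"
    then show "(\<Sum>j\<le>p - s. (p + \<alpha> gchoose (p - s)) * (p + \<beta> gchoose s)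
        * real ((p - s) choose j) * u ^ (s + j)) =
      (\<Sum>r = s..p. (p + \<alpha> gchoose (p - s)) * (p + \<beta> gchoose s)
        * real ((p - s) choose (r - s)) * u ^ r)"
      by (intro sum.reindex_bij_witness[of _ "\<lambda>r. r - s" "\<lambda>j. s + j"]) auto
  qed
  also have "\<dots> = (\<Sum>r\<le>p. \<Sum>s\<le>r. (p + \<alpha> gchoose (p - s)) * (p + \<beta> gchoose s)
      * real ((p - s) choose (r - s)) * u ^ r)"
    by (subst (1 2) sum.Sigma) (auto intro!: sum.reindex_bij_witness[of _ prod.swap prod.swap])
  also have "\<dots> = (\<Sum>r\<le>p. shifted_jacobi_coeff m \<alpha> \<beta> r * u ^ r)"
  proof (rule sum.cong, rule refl)
    fix r assume "r \<in> {..p}"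
    then have r: "r \<le> p" by simp
    \<comment> \<open>Trinomial revision pulls out a factor free of s; what remains is the
      Vandermonde convolution of p + \<beta> and r + \<alpha>.\<close>
    have revision: "(p + \<alpha> gchoose (p - s)) * real ((p - s) choose (r - s)) =
        (p + \<alpha> gchoose (p - r)) * (r + \<alpha> gchoose (r - s))" if "s \<le> r" for s
    proof -
      have "real ((p - s) choose (r - s)) = real (p - s) gchoose (p - r)"
        using r that binomial_symmetric[of "r - s" "p - s"] by (simp add: binomial_gbinomial)
      then show ?thesis
        using r that gbinomial_trinomial_revision[of "p - r" "p - s" "p + \<alpha>"]
        by (simp add: of_nat_diff algebra_simps)
    qed
    have "(\<Sum>s\<le>r. (p + \<alpha> gchoose (p - s)) * (p + \<beta> gchoose s) * real ((p - s) choose (r - s)) * u ^ r) =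
        (\<Sum>s\<le>r. (p + \<alpha> gchoose (p - r)) * u ^ r * ((p + \<beta> gchoose s) * (r + \<alpha> gchoose (r - s))))"
    proof (rule sum.cong, rule refl)
      fix s assume "s \<in> {..r}"
      then show "(p + \<alpha> gchoose (p - s)) * (p + \<beta> gchoose s) * real ((p - s) choose (r - s)) * u ^ r =
          (p + \<alpha> gchoose (p - r)) * u ^ r * ((p + \<beta> gchoose s) * (r + \<alpha> gchoose (r - s)))"
        using revision[of s] by (simp add: mult.assoc mult.left_commute)
    qed
    also have "\<dots> = (p + \<alpha> gchoose (p - r)) * u ^ r * ((p + \<beta>) + (r + \<alpha>) gchoose r)"
      by (simp add: gbinomial_Vandermonde[symmetric] sum_distrib_left atLeast0AtMost)
    also have "\<dots> = shifted_jacobi_coeff m \<alpha> \<beta> r * u ^ r"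
      using r by (simp add: shifted_jacobi_coeff_def m nat_diff_distrib add_ac)
    finally show "(\<Sum>s\<le>r. (p + \<alpha> gchoose (p - s)) * (p + \<beta> gchoose s)
        * real ((p - s) choose (r - s)) * u ^ r) = shifted_jacobi_coeff m \<alpha> \<beta> r * u ^ r" .
  qed
  also have "\<dots> = (\<Sum>s<K. shifted_jacobi_coeff m \<alpha> \<beta> s * u ^ s)"
    using assms by (intro sum.mono_neutral_left) (auto simp: m)
  finally show ?thesis by (simp add: u_def)
qed

section \<open>Relations between coefficients\<close>

lemma shifted_jacobi_coeff_Suc:
  "real (Suc s) * shifted_jacobi_coeff m \<alpha> \<beta> (Suc s) =
     (of_int m + \<alpha> + \<beta> + 1) * shifted_jacobi_coeff (m - 1) (\<alpha> + 1) (\<beta> + 1) s"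
proof (cases m s rule: le_int_cases)
  case (3 i)
  define A where "A = of_int m + \<alpha>"
  define B where "B = of_int m + \<alpha> + \<beta> + real s + 1"
  have "shifted_jacobi_coeff m \<alpha> \<beta> (Suc s) = (A gchoose i) * (B gchoose Suc s)"
    "shifted_jacobi_coeff (m - 1) (\<alpha> + 1) (\<beta> + 1) s = (A gchoose i) * (B gchoose s)"
    by (rule shifted_jacobi_coeff_eqI; simp add: 3 A_def B_def)+
  \<comment> \<open>The factor (A choose i) is common to both sides, and B - s is m + \<alpha> +
    \<beta> + 1.\<close>
  then show ?thesis
    using real_Suc_times_gbinomial_Suc[of s B] by (simp add: B_def)
qed auto

text \<open>Absorption in B makes (B choose s) a common factor. Pascal's rule splits (A + 1 choose i
  + 1), and the excess (A - i) (A choose i) equals (i + 1) (A choose i + 1).\<close>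

lemma shifted_jacobi_coeff_raise_alpha:
  "(2 * of_int m + \<alpha> + \<beta> + 1) * shifted_jacobi_coeff m \<alpha> \<beta> s =
     (of_int m + \<alpha> + \<beta> + 1) * shifted_jacobi_coeff m (\<alpha> + 1) \<beta> s
     - (of_int m + \<beta>) * shifted_jacobi_coeff (m - 1) (\<alpha> + 1) \<beta> s"
proof -
  define A where "A = of_int m + \<alpha>"
  define B where "B = of_int m + \<alpha> + \<beta> + real s"
  have B: "(B + 1 - real s) * (B + 1 gchoose s) = (B + 1) * (B gchoose s)"
    using gbinomial_absorb_comp[of "B + 1" s] by simp
  show ?thesis
  proof (cases m s rule: le_int_cases)
    case 2
    have "shifted_jacobi_coeff m \<alpha> \<beta> s = (A gchoose 0) * (B gchoose s)"
      "shifted_jacobi_coeff m (\<alpha> + 1) \<beta> s = (A + 1 gchoose 0) * (B + 1 gchoose s)"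
      by (rule shifted_jacobi_coeff_eqI; simp add: 2 A_def B_def)+
    then show ?thesis using B by (simp add: 2 B_def algebra_simps)
  next
    case (3 i)
    have coeffs: "shifted_jacobi_coeff m \<alpha> \<beta> s = (A gchoose Suc i) * (B gchoose s)"
      "shifted_jacobi_coeff m (\<alpha> + 1) \<beta> s = (A + 1 gchoose Suc i) * (B + 1 gchoose s)"
      "shifted_jacobi_coeff (m - 1) (\<alpha> + 1) \<beta> s = (A gchoose i) * (B gchoose s)"
      by (rule shifted_jacobi_coeff_eqI; simp add: 3 A_def B_def)+
    have N: "of_int m + \<alpha> + \<beta> + 1 = B + 1 - real s"
      "2 * of_int m + \<alpha> + \<beta> + 1 = B + 1 + real (Suc i)"
      "of_int m + \<beta> = B + 1 - (A - real i)"
      by (simp_all add: 3 A_def B_def)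
    show ?thesis
      unfolding coeffs N gbinomial_Suc_Suc
      using B real_Suc_times_gbinomial_Suc[of i A] by algebra
  qed auto
qed

text \<open>Raising \<beta> leaves A unchanged in degree m, so absorption in A replaces Pascal's
  rule.\<close>

lemma shifted_jacobi_coeff_raise_beta:
  "(2 * of_int m + \<alpha> + \<beta> + 1) * shifted_jacobi_coeff m \<alpha> \<beta> s =
     (of_int m + \<alpha> + \<beta> + 1) * shifted_jacobi_coeff m \<alpha> (\<beta> + 1) s
     + (of_int m + \<alpha>) * shifted_jacobi_coeff (m - 1) \<alpha> (\<beta> + 1) s"
proof -
  define A where "A = of_int m + \<alpha>"
  define B where "B = of_int m + \<alpha> + \<beta> + real s"
  have B: "(B + 1 - real s) * (B + 1 gchoose s) = (B + 1) * (B gchoose s)"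
    using gbinomial_absorb_comp[of "B + 1" s] by simp
  show ?thesis
  proof (cases m s rule: le_int_cases)
    case 2
    have "shifted_jacobi_coeff m \<alpha> \<beta> s = (A gchoose 0) * (B gchoose s)"
      "shifted_jacobi_coeff m \<alpha> (\<beta> + 1) s = (A gchoose 0) * (B + 1 gchoose s)"
      by (rule shifted_jacobi_coeff_eqI; simp add: 2 A_def B_def)+
    then show ?thesis using B by (simp add: 2 B_def algebra_simps)
  next
    case (3 i)
    have coeffs: "shifted_jacobi_coeff m \<alpha> \<beta> s = (A gchoose Suc i) * (B gchoose s)"
      "shifted_jacobi_coeff m \<alpha> (\<beta> + 1) s = (A gchoose Suc i) * (B + 1 gchoose s)"
      "shifted_jacobi_coeff (m - 1) \<alpha> (\<beta> + 1) s = (A - 1 gchoose i) * (B gchoose s)"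
      by (rule shifted_jacobi_coeff_eqI; simp add: 3 A_def B_def)+
    have N: "of_int m + \<alpha> + \<beta> + 1 = B + 1 - real s"
      "2 * of_int m + \<alpha> + \<beta> + 1 = B + 1 + real (Suc i)"
      "of_int m + \<alpha> = A"
      by (simp_all add: 3 A_def B_def)
    show ?thesis
      unfolding coeffs N(1,2) unfolding N(3)
      using B gbinomial_absorption[of i A] by algebra
  qed auto
qed

text \<open>The left side is the coefficient of m P - (x - 1) P'. The changes of m and \<beta>
  cancel in B, so only absorption in A is involved.\<close>

lemma shifted_jacobi_coeff_lower_degree_raise_beta:
  "(of_int m - real s) * shifted_jacobi_coeff m \<alpha> \<beta> s =
     (of_int m + \<alpha>) * shifted_jacobi_coeff (m - 1) \<alpha> (\<beta> + 1) s"
proof (cases m s rule: le_int_cases)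
  case (3 i)
  define A where "A = of_int m + \<alpha>"
  define B where "B = of_int m + \<alpha> + \<beta> + real s"
  have "shifted_jacobi_coeff m \<alpha> \<beta> s = (A gchoose Suc i) * (B gchoose s)"
    "shifted_jacobi_coeff (m - 1) \<alpha> (\<beta> + 1) s = (A - 1 gchoose i) * (B gchoose s)"
    by (rule shifted_jacobi_coeff_eqI; simp add: 3 A_def B_def)+
  moreover have "of_int m - real s = real (Suc i)" "of_int m + \<alpha> = A"
    by (simp_all add: 3 A_def)
  ultimately show ?thesis
    by (simp add: gbinomial_absorption[symmetric] del: of_nat_Suc)
qed auto

text \<open>Coefficient form of x P' - m P, with x = (x - 1) + 1. Both sides equal (B + 1) (A choose
  i) (B choose s) in the generic case.\<close>

lemma shifted_jacobi_coeff_lower_degree_raise_alpha: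
  "real (Suc s) * shifted_jacobi_coeff m \<alpha> \<beta> (Suc s) =
     (of_int m - real s) * shifted_jacobi_coeff m \<alpha> \<beta> s
     + (of_int m + \<beta>) * shifted_jacobi_coeff (m - 1) (\<alpha> + 1) \<beta> s"
proof (cases m s rule: le_int_cases)
  case (3 i)
  define A where "A = of_int m + \<alpha>"
  define B where "B = of_int m + \<alpha> + \<beta> + real s"
  have coeffs: "shifted_jacobi_coeff m \<alpha> \<beta> (Suc s) = (A gchoose i) * (B + 1 gchoose Suc s)"
    "shifted_jacobi_coeff m \<alpha> \<beta> s = (A gchoose Suc i) * (B gchoose s)"
    "shifted_jacobi_coeff (m - 1) (\<alpha> + 1) \<beta> s = (A gchoose i) * (B gchoose s)"
    by (rule shifted_jacobi_coeff_eqI; simp add: 3 A_def B_def)+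
  have N: "of_int m - real s = real (Suc i)" "of_int m + \<beta> = B + 1 - (A - real i)"
    by (simp_all add: 3 A_def B_def)
  show ?thesis
    unfolding coeffs N
    using real_Suc_times_gbinomial_Suc[of i A] Suc_times_gbinomial[of s B] by algebra
qed auto

text \<open>B is unchanged and A drops by 1. As the degree does not drop, m = s needs no separate
  treatment.\<close>

lemma shifted_jacobi_coeff_lower_alpha_raise_beta:
  "(\<alpha> + real s) * shifted_jacobi_coeff m \<alpha> \<beta> s =
     (of_int m + \<alpha>) * shifted_jacobi_coeff m (\<alpha> - 1) (\<beta> + 1) s"
proof (cases "m < int s")
  case False
  then obtain j where m: "m = int s + int j" by (metis zle_iff_zadd not_less)
  define A where "A = of_int m + \<alpha>"
  define B where "B = of_int m + \<alpha> + \<beta> + real s"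
  have "shifted_jacobi_coeff m \<alpha> \<beta> s = (A gchoose j) * (B gchoose s)"
    "shifted_jacobi_coeff m (\<alpha> - 1) (\<beta> + 1) s = (A - 1 gchoose j) * (B gchoose s)"
    by (rule shifted_jacobi_coeff_eqI; simp add: m A_def B_def)+
  moreover have "\<alpha> + real s = A - real j" "of_int m + \<alpha> = A"
    by (simp_all add: m A_def)
  ultimately show ?thesis
    using gbinomial_absorb_comp[of A j] by simp
qed simp

section \<open>Derivative and contiguous relations in one variable\<close>

lemma has_real_derivative_shifted_jacobi_poly:
  "(shifted_jacobi_poly m \<alpha> \<beta> has_real_derivative
     (of_int m + \<alpha> + \<beta> + 1) * shifted_jacobi_poly (m - 1) (\<alpha> + 1) (\<beta> + 1) x) (at x)"
proof -
  define K where "K = Suc (nat m)"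
  have K: "m < int (Suc K)" "m - 1 < int K" by (simp_all add: K_def)
  have "((\<lambda>x. \<Sum>s<Suc K. shifted_jacobi_coeff m \<alpha> \<beta> s * (x - 1) ^ s) has_real_derivative
      (\<Sum>s<Suc K. shifted_jacobi_coeff m \<alpha> \<beta> s * (real s * (x - 1) ^ (s - 1)))) (at x)"
    by (rule DERIV_sum, rule DERIV_cmult) (auto intro!: derivative_eq_intros)
  also have "(\<lambda>x. \<Sum>s<Suc K. shifted_jacobi_coeff m \<alpha> \<beta> s * (x - 1) ^ s) =
      shifted_jacobi_poly m \<alpha> \<beta>"
    by (rule ext) (simp only: shifted_jacobi_poly_expansion[OF K(1)])
  also have "(\<Sum>s<Suc K. shifted_jacobi_coeff m \<alpha> \<beta> s * (real s * (x - 1) ^ (s - 1))) =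
      (\<Sum>s<K. real (Suc s) * shifted_jacobi_coeff m \<alpha> \<beta> (Suc s) * (x - 1) ^ s)"
    by (subst sum.lessThan_Suc_shift) (simp add: mult_ac)
  also have "\<dots> = (of_int m + \<alpha> + \<beta> + 1) * shifted_jacobi_poly (m - 1) (\<alpha> + 1) (\<beta> + 1) x"
    by (simp only: shifted_jacobi_coeff_Suc shifted_jacobi_poly_expansion[OF K(2)]
        sum_distrib_left mult.assoc)
  finally show ?thesis .
qed

lemma deriv_shifted_jacobi_poly:
  "deriv (shifted_jacobi_poly m \<alpha> \<beta>) x =
     (of_int m + \<alpha> + \<beta> + 1) * shifted_jacobi_poly (m - 1) (\<alpha> + 1) (\<beta> + 1) x"
  by (rule DERIV_imp_deriv) (rule has_real_derivative_shifted_jacobi_poly)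

lemma shifted_jacobi_poly_raise_alpha:
  "(2 * of_int m + \<alpha> + \<beta> + 1) * shifted_jacobi_poly m \<alpha> \<beta> x =
     (of_int m + \<alpha> + \<beta> + 1) * shifted_jacobi_poly m (\<alpha> + 1) \<beta> x
     - (of_int m + \<beta>) * shifted_jacobi_poly (m - 1) (\<alpha> + 1) \<beta> x"
proof -
  define K where "K = Suc (nat m)"
  have K: "m < int K" "m - 1 < int K" by (simp_all add: K_def)
  show ?thesis
    unfolding shifted_jacobi_poly_expansion[OF K(1)] shifted_jacobi_poly_expansion[OF K(2)]
      sum_distrib_left mult.assoc[symmetric] shifted_jacobi_coeff_raise_alpha
    by (simp add: left_diff_distrib sum_subtractf)
qed

lemma shifted_jacobi_poly_raise_beta:
  "(2 * of_int m + \<alpha> + \<beta> + 1) * shifted_jacobi_poly m \<alpha> \<beta> x =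
     (of_int m + \<alpha> + \<beta> + 1) * shifted_jacobi_poly m \<alpha> (\<beta> + 1) x
     + (of_int m + \<alpha>) * shifted_jacobi_poly (m - 1) \<alpha> (\<beta> + 1) x"
proof -
  define K where "K = Suc (nat m)"
  have K: "m < int K" "m - 1 < int K" by (simp_all add: K_def)
  show ?thesis
    unfolding shifted_jacobi_poly_expansion[OF K(1)] shifted_jacobi_poly_expansion[OF K(2)]
      sum_distrib_left mult.assoc[symmetric] shifted_jacobi_coeff_raise_beta
    by (simp add: distrib_right sum.distrib)
qed

text \<open>In this basis (x - 1) d/dx is diagonal and d/dx is a weighted shift, so first-order
  operators turn into the coefficient relations above.\<close>

lemma deriv_shifted_jacobi_poly_expansion:
  assumes "m < int K"
  shows "deriv (shifted_jacobi_poly m \<alpha> \<beta>) x =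
      (\<Sum>s<K. real (Suc s) * shifted_jacobi_coeff m \<alpha> \<beta> (Suc s) * (x - 1) ^ s)"
    and "(x - 1) * deriv (shifted_jacobi_poly m \<alpha> \<beta>) x =
      (\<Sum>s<K. real s * shifted_jacobi_coeff m \<alpha> \<beta> s * (x - 1) ^ s)"
proof -
  have K: "m - 1 < int K" using assms by simp
  show *: "deriv (shifted_jacobi_poly m \<alpha> \<beta>) x =
      (\<Sum>s<K. real (Suc s) * shifted_jacobi_coeff m \<alpha> \<beta> (Suc s) * (x - 1) ^ s)"
    by (simp only: deriv_shifted_jacobi_poly shifted_jacobi_coeff_Suc
        shifted_jacobi_poly_expansion[OF K] sum_distrib_left mult.assoc)
  have "(x - 1) * deriv (shifted_jacobi_poly m \<alpha> \<beta>) x =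
      (\<Sum>s<K. real (Suc s) * shifted_jacobi_coeff m \<alpha> \<beta> (Suc s) * (x - 1) ^ Suc s)"
    unfolding * sum_distrib_left by (simp add: mult_ac)
  also have "\<dots> = (\<Sum>s<Suc K. real s * shifted_jacobi_coeff m \<alpha> \<beta> s * (x - 1) ^ s)"
    by (subst sum.lessThan_Suc_shift) simp
  \<comment> \<open>The term s = K vanishes because m < K.\<close>
  also have "\<dots> = (\<Sum>s<K. real s * shifted_jacobi_coeff m \<alpha> \<beta> s * (x - 1) ^ s)"
    using assms by simp
  finally show "(x - 1) * deriv (shifted_jacobi_poly m \<alpha> \<beta>) x =
      (\<Sum>s<K. real s * shifted_jacobi_coeff m \<alpha> \<beta> s * (x - 1) ^ s)" .
qed

text \<open>This operator, taken at y / (1 - x), comes from differentiating (1 - x)^k G(y / (1 - x))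
  in x.\<close>

lemma shifted_jacobi_poly_lower_degree_raise_alpha:
  "x * deriv (shifted_jacobi_poly m \<alpha> \<beta>) x - of_int m * shifted_jacobi_poly m \<alpha> \<beta> x =
     (of_int m + \<beta>) * shifted_jacobi_poly (m - 1) (\<alpha> + 1) \<beta> x"
proof -
  define K where "K = Suc (nat m)"
  have K: "m < int K" "m - 1 < int K" by (simp_all add: K_def)
  let ?D = "deriv (shifted_jacobi_poly m \<alpha> \<beta>) x"
  have "x * ?D = (x - 1) * ?D + ?D" by (simp add: left_diff_distrib)
  also have "\<dots> - of_int m * shifted_jacobi_poly m \<alpha> \<beta> x =
      (\<Sum>s<K. (real s * shifted_jacobi_coeff m \<alpha> \<beta> s
        + real (Suc s) * shifted_jacobi_coeff m \<alpha> \<beta> (Suc s)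
        - of_int m * shifted_jacobi_coeff m \<alpha> \<beta> s) * (x - 1) ^ s)"
    unfolding deriv_shifted_jacobi_poly_expansion(2)[OF K(1)]
    unfolding deriv_shifted_jacobi_poly_expansion(1)[OF K(1)] shifted_jacobi_poly_expansion[OF K(1)]
    by (simp only: left_diff_distrib distrib_right sum.distrib sum_subtractf sum_distrib_left mult.assoc)
  also have "\<dots> = (\<Sum>s<K. (of_int m + \<beta>) * shifted_jacobi_coeff (m - 1) (\<alpha> + 1) \<beta> s * (x - 1) ^ s)"
    unfolding shifted_jacobi_coeff_lower_degree_raise_alpha by (simp add: left_diff_distrib)
  also have "\<dots> = (of_int m + \<beta>) * shifted_jacobi_poly (m - 1) (\<alpha> + 1) \<beta> x"
    by (simp only: shifted_jacobi_poly_expansion[OF K(2)] sum_distrib_left mult.assoc)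
  finally show ?thesis .
qed

text \<open>The counterpart for the z-derivative: subtracting w G' - k G from G' gives (1 - w) G' +
  k G.\<close>

lemma shifted_jacobi_poly_lower_degree_raise_beta:
  "(1 - x) * deriv (shifted_jacobi_poly m \<alpha> \<beta>) x + of_int m * shifted_jacobi_poly m \<alpha> \<beta> x =
     (of_int m + \<alpha>) * shifted_jacobi_poly (m - 1) \<alpha> (\<beta> + 1) x"
proof -
  define K where "K = Suc (nat m)"
  have K: "m < int K" "m - 1 < int K" by (simp_all add: K_def)
  let ?D = "deriv (shifted_jacobi_poly m \<alpha> \<beta>) x"
  have "(1 - x) * ?D + of_int m * shifted_jacobi_poly m \<alpha> \<beta> x =
      of_int m * shifted_jacobi_poly m \<alpha> \<beta> x - (x - 1) * ?D"
    by (simp add: left_diff_distrib)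
  also have "\<dots> = (\<Sum>s<K. (of_int m - real s) * shifted_jacobi_coeff m \<alpha> \<beta> s * (x - 1) ^ s)"
    unfolding deriv_shifted_jacobi_poly_expansion(2)[OF K(1)] shifted_jacobi_poly_expansion[OF K(1)]
    by (simp only: left_diff_distrib sum_subtractf sum_distrib_left mult.assoc)
  also have "\<dots> = (of_int m + \<alpha>) * shifted_jacobi_poly (m - 1) \<alpha> (\<beta> + 1) x"
    by (simp only: shifted_jacobi_coeff_lower_degree_raise_beta
        shifted_jacobi_poly_expansion[OF K(2)] sum_distrib_left mult.assoc)
  finally show ?thesis .
qed

text \<open>Applied to the factor in x, where \<alpha> is 2k + b + c + 1, this merges the terms with
  F and F' into one polynomial.\<close>

lemma shifted_jacobi_poly_lower_alpha_raise_beta: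
  "\<alpha> * shifted_jacobi_poly m \<alpha> \<beta> x - (1 - x) * deriv (shifted_jacobi_poly m \<alpha> \<beta>) x =
     (of_int m + \<alpha>) * shifted_jacobi_poly m (\<alpha> - 1) (\<beta> + 1) x"
proof -
  define K where "K = Suc (nat m)"
  have K: "m < int K" by (simp add: K_def)
  let ?D = "deriv (shifted_jacobi_poly m \<alpha> \<beta>) x"
  have "\<alpha> * shifted_jacobi_poly m \<alpha> \<beta> x - (1 - x) * ?D =
      \<alpha> * shifted_jacobi_poly m \<alpha> \<beta> x + (x - 1) * ?D"
    by (simp add: left_diff_distrib)
  also have "\<dots> = (\<Sum>s<K. (\<alpha> + real s) * shifted_jacobi_coeff m \<alpha> \<beta> s * (x - 1) ^ s)"
    unfolding deriv_shifted_jacobi_poly_expansion(2)[OF K] shifted_jacobi_poly_expansion[OF K]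
    by (simp only: distrib_right sum.distrib sum_distrib_left mult.assoc)
  also have "\<dots> = (of_int m + \<alpha>) * shifted_jacobi_poly m (\<alpha> - 1) (\<beta> + 1) x"
    by (simp only: shifted_jacobi_coeff_lower_alpha_raise_beta
        shifted_jacobi_poly_expansion[OF K] sum_distrib_left mult.assoc)
  finally show ?thesis .
qed

section \<open>Partial derivatives of the triangle polynomial\<close>

text \<open>No case distinction on the indices: the one-variable polynomials already vanish in
  negative degree.\<close>

lemma triangle_jacobi_eq:
  "triangle_jacobi n k a b c x y =
     shifted_jacobi_poly (n - k) (2 * of_int k + b + c + 1) a x * (1 - x) ^ nat k
     * shifted_jacobi_poly k c b (y / (1 - x))"
  by (simp add: triangle_jacobi_def shifted_jacobi_poly_def jacobi_poly_def)

text \<open>For k \<le> 0 both exponents are truncated to 0 and the powers no longer differ by a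
  factor u, but then the polynomial of degree k - 1 is zero.\<close>

lemma shifted_jacobi_poly_times_power:
  "shifted_jacobi_poly (k - 1) \<alpha> \<beta> t * u ^ nat k =
     shifted_jacobi_poly (k - 1) \<alpha> \<beta> t * (u * u ^ nat (k - 1))"
proof (cases "1 \<le> k")
  case True
  then have "nat k = Suc (nat (k - 1))" by simp
  then show ?thesis by simp
next
  case False
  then show ?thesis by (simp add: shifted_jacobi_poly_def jacobi_poly_def)
qed

lemma deriv_shifted_jacobi_poly_times_power:
  "deriv (shifted_jacobi_poly k \<alpha> \<beta>) t * u ^ nat k =
     deriv (shifted_jacobi_poly k \<alpha> \<beta>) t * (u * u ^ nat (k - 1))"
  by (simp add: deriv_shifted_jacobi_poly shifted_jacobi_poly_times_power mult.assoc)

lemma has_real_derivative_triangle_jacobi_x: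
  fixes n k :: int and a b c x y :: real
  assumes "0 \<le> k" "x \<noteq> 1"
  defines "F \<equiv> shifted_jacobi_poly (n - k) (2 * of_int k + b + c + 1) a"
    and "G \<equiv> shifted_jacobi_poly k c b" and "w \<equiv> y / (1 - x)"
  shows "((\<lambda>t. triangle_jacobi n k a b c t y) has_real_derivative
     deriv F x * (1 - x) ^ nat k * G w
     + F x * (1 - x) ^ nat (k - 1) * (w * deriv G w - of_int k * G w)) (at x)"
proof -
  have F: "(F has_real_derivative deriv F x) (at x)"
    unfolding F_def deriv_shifted_jacobi_poly by (rule has_real_derivative_shifted_jacobi_poly)
  have G: "(G has_real_derivative deriv G w) (at w)"
    unfolding G_def deriv_shifted_jacobi_poly by (rule has_real_derivative_shifted_jacobi_poly)
  have w: "((\<lambda>t. y / (1 - t)) has_real_derivative w / (1 - x)) (at x)"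
    using assms(2) by (auto intro!: derivative_eq_intros simp: w_def)
  have Gw: "((\<lambda>t. G (y / (1 - t))) has_real_derivative deriv G w * (w / (1 - x))) (at x)"
    using DERIV_chain2[OF G[unfolded w_def] w] by (simp add: w_def)
  have nat_pred: "nat (k - 1) = nat k - Suc 0"
    by arith
  have pow: "((\<lambda>t. (1 - t) ^ nat k) has_real_derivative
      - of_int k * (1 - x) ^ nat (k - 1)) (at x)"
    using assms(1) by (auto intro!: derivative_eq_intros simp: nat_pred)
  have "deriv G w * (1 - x) ^ nat k * (w / (1 - x)) = deriv G w * (1 - x) ^ nat (k - 1) * w"
    unfolding G_def deriv_shifted_jacobi_poly_times_power using assms(2) by simp
  \<comment> \<open>The hypothesis keeps the factor G', because r * v = q * w alone can fail at k =
    0.\<close>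
  moreover have "(F' * r + - of_int k * q * F x) * G w + G' * v * (F x * r) =
      F' * r * G w + F x * q * (w * G' - of_int k * G w)"
    if "G' * r * v = G' * q * w" for F' G' r q v
    using that by algebra
  ultimately have "(deriv F x * (1 - x) ^ nat k + - of_int k * (1 - x) ^ nat (k - 1) * F x) * G w
        + deriv G w * (w / (1 - x)) * (F x * (1 - x) ^ nat k) =
      deriv F x * (1 - x) ^ nat k * G w
        + F x * (1 - x) ^ nat (k - 1) * (w * deriv G w - of_int k * G w)"
    by blast
  then show ?thesis
    using DERIV_mult[OF DERIV_mult[OF F pow] Gw]
    unfolding triangle_jacobi_eq F_def[symmetric] G_def[symmetric] by (simp add: w_def)
qed

lemma has_real_derivative_triangle_jacobi_y:
  fixes a b c x y :: real
  assumes "x \<noteq> 1"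
  shows "((\<lambda>t. triangle_jacobi n k a b c x t) has_real_derivative
     shifted_jacobi_poly (n - k) (2 * of_int k + b + c + 1) a x * (1 - x) ^ nat (k - 1)
     * deriv (shifted_jacobi_poly k c b) (y / (1 - x))) (at y)"
proof -
  define F where "F = shifted_jacobi_poly (n - k) (2 * of_int k + b + c + 1) a x"
  define G where "G = shifted_jacobi_poly k c b"
  define w where "w = y / (1 - x)"
  have G: "(G has_real_derivative deriv G w) (at w)"
    unfolding G_def deriv_shifted_jacobi_poly by (rule has_real_derivative_shifted_jacobi_poly)
  have w: "((\<lambda>t. t / (1 - x)) has_real_derivative 1 / (1 - x)) (at y)"
    by (rule DERIV_cdivide) simp
  have "deriv G w * (1 - x) ^ nat k * (1 / (1 - x)) = deriv G w * (1 - x) ^ nat (k - 1)"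
    unfolding G_def deriv_shifted_jacobi_poly_times_power using assms by simp
  then have "F * (1 - x) ^ nat k * (deriv G w * (1 / (1 - x))) =
      F * (1 - x) ^ nat (k - 1) * deriv G w"
    by (simp only: mult_ac)
  then show ?thesis
    using DERIV_cmult[OF DERIV_chain2[OF G[unfolded w_def] w], of "F * (1 - x) ^ nat k"]
    unfolding triangle_jacobi_eq F_def[symmetric] G_def[symmetric] by (simp add: w_def)
qed

section \<open>The three derivative formulas\<close>

theorem corollary1:
  fixes n k :: int and a b c x y :: real
  assumes "0 \<le> k" and "k \<le> n" and "x \<noteq> 1"
  shows "(\<lambda>t. triangle_jacobi n k a b c t y) differentiable at x
    \<and> (\<lambda>t. triangle_jacobi n k a b c x t) differentiable at y
    \<and> (2 * of_int k + b + c + 1) * partial_x (triangle_jacobi n k a b c) x y =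
        (of_int n + of_int k + a + b + c + 2) * (of_int k + b + c + 1)
          * triangle_jacobi (n - 1) k (a + 1) b (c + 1) x y
        + (of_int k + b) * (of_int n + of_int k + b + c + 1)
          * triangle_jacobi (n - 1) (k - 1) (a + 1) b (c + 1) x y
    \<and> partial_y (triangle_jacobi n k a b c) x y =
        (of_int k + b + c + 1) * triangle_jacobi (n - 1) (k - 1) a (b + 1) (c + 1) x y
    \<and> (2 * of_int k + b + c + 1) * partial_z (triangle_jacobi n k a b c) x y =
        - (of_int n + of_int k + a + b + c + 2) * (of_int k + b + c + 1)
          * triangle_jacobi (n - 1) k (a + 1) (b + 1) c x y
        + (of_int k + c) * (of_int n + of_int k + b + c + 1)
          * triangle_jacobi (n - 1) (k - 1) (a + 1) (b + 1) c x y"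
proof -
  define A where "A = 2 * of_int k + b + c + 1"
  define F where "F = shifted_jacobi_poly (n - k) A a"
  define G where "G = shifted_jacobi_poly k c b"
  define w where "w = y / (1 - x)"
  define r where "r = (1 - x) ^ nat k"
  define q where "q = (1 - x) ^ nat (k - 1)"
  \<comment> \<open>The factor in x common to the polynomials of index (n - 1, k - 1) in the x- and
    z-formulas: 2(k - 1) + b + c + 2 = A - 1.\<close>
  define F1 where "F1 = shifted_jacobi_poly (n - k) (A - 1) (a + 1) x"
  define H where "H j = shifted_jacobi_poly j (c + 1) b w" for j
  define K where "K j = shifted_jacobi_poly j c (b + 1) w" for j
  have dx: "((\<lambda>t. triangle_jacobi n k a b c t y) has_real_derivative
      deriv F x * r * G w + F x * q * (w * deriv G w - of_int k * G w)) (at x)"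
    using has_real_derivative_triangle_jacobi_x[OF assms(1,3)]
    unfolding F_def G_def A_def r_def q_def w_def by simp
  have dy: "((\<lambda>t. triangle_jacobi n k a b c x t) has_real_derivative
      F x * q * deriv G w) (at y)"
    using has_real_derivative_triangle_jacobi_y[OF assms(3)]
    unfolding F_def G_def A_def q_def w_def by simp
  note px = DERIV_imp_deriv[OF dx, folded partial_x_def]
  note py = DERIV_imp_deriv[OF dy, folded partial_y_def]

  have F': "deriv F x =
      (of_int n + of_int k + a + b + c + 2) * shifted_jacobi_poly (n - k - 1) (A + 1) (a + 1) x"
    unfolding F_def deriv_shifted_jacobi_poly by (simp add: A_def algebra_simps)
  have F1: "A * F x - (1 - x) * deriv F x = (of_int n + of_int k + b + c + 1) * F1"
    using shifted_jacobi_poly_lower_alpha_raise_beta[of A "n - k" a x]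
    by (simp add: F_def F1_def) (simp add: A_def algebra_simps)
  \<comment> \<open>A is both the first parameter of F and the constant 2k + c + b + 1 of the
    raising relations for G; hence the multiplier 2k + b + c + 1 in the theorem.\<close>
  have H: "A * G w = (of_int k + b + c + 1) * H k - (of_int k + b) * H (k - 1)"
    "w * deriv G w - of_int k * G w = (of_int k + b) * H (k - 1)"
    "H (k - 1) * r = H (k - 1) * ((1 - x) * q)"
    using shifted_jacobi_poly_raise_alpha[of k c b w]
      shifted_jacobi_poly_lower_degree_raise_alpha[of w k c b]
    by (simp_all add: A_def G_def H_def r_def q_def shifted_jacobi_poly_times_power add_ac)
  have K: "A * G w = (of_int k + b + c + 1) * K k + (of_int k + c) * K (k - 1)"
    "(1 - w) * deriv G w + of_int k * G w = (of_int k + c) * K (k - 1)"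
    "K (k - 1) * r = K (k - 1) * ((1 - x) * q)"
    using shifted_jacobi_poly_raise_beta[of k c b w]
      shifted_jacobi_poly_lower_degree_raise_beta[of w k c b]
    by (simp_all add: A_def G_def K_def r_def q_def shifted_jacobi_poly_times_power add_ac)

  have x1: "(of_int n + of_int k + a + b + c + 2)
      * triangle_jacobi (n - 1) k (a + 1) b (c + 1) x y = deriv F x * r * H k"
    unfolding F' triangle_jacobi_eq r_def H_def w_def A_def by (simp add: algebra_simps)
  have x2: "triangle_jacobi (n - 1) (k - 1) (a + 1) b (c + 1) x y = F1 * q * H (k - 1)"
    unfolding triangle_jacobi_eq F1_def q_def H_def w_def A_def by (simp add: algebra_simps)
  have z1: "(of_int n + of_int k + a + b + c + 2)
      * triangle_jacobi (n - 1) k (a + 1) (b + 1) c x y = deriv F x * r * K k"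
    unfolding F' triangle_jacobi_eq r_def K_def w_def A_def by (simp add: algebra_simps)
  have z2: "triangle_jacobi (n - 1) (k - 1) (a + 1) (b + 1) c x y = F1 * q * K (k - 1)"
    unfolding triangle_jacobi_eq F1_def q_def K_def w_def A_def by (simp add: algebra_simps)

  have "A * partial_x (triangle_jacobi n k a b c) x y =
      (of_int n + of_int k + a + b + c + 2) * (of_int k + b + c + 1)
        * triangle_jacobi (n - 1) k (a + 1) b (c + 1) x y
      + (of_int k + b) * (of_int n + of_int k + b + c + 1)
        * triangle_jacobi (n - 1) (k - 1) (a + 1) b (c + 1) x y"
    \<comment> \<open>With \<open>H\<close>, the terms in H (k - 1) add up to (k + b) q H (k - 1) (A
      F - (1 - x) F'), and \<open>F1\<close> evaluates the bracket.\<close>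
    unfolding px x2 using H F1 x1 by algebra
  moreover have "partial_y (triangle_jacobi n k a b c) x y =
      (of_int k + b + c + 1) * triangle_jacobi (n - 1) (k - 1) a (b + 1) (c + 1) x y"
    \<comment> \<open>The factor in x is already the right one, since 2(k - 1) + (b + 1) + (c + 1) +
      1 = A; only G is differentiated.\<close>
    unfolding py triangle_jacobi_eq F_def G_def deriv_shifted_jacobi_poly q_def w_def A_def
    by (simp add: algebra_simps)
  moreover have "A * partial_z (triangle_jacobi n k a b c) x y =
      - (of_int n + of_int k + a + b + c + 2) * (of_int k + b + c + 1)
        * triangle_jacobi (n - 1) k (a + 1) (b + 1) c x y
      + (of_int k + c) * (of_int n + of_int k + b + c + 1)
        * triangle_jacobi (n - 1) (k - 1) (a + 1) (b + 1) c x y"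
    \<comment> \<open>The same bracket A F - (1 - x) F' now multiplies (k + c) q K (k - 1).\<close>
    unfolding partial_z_def px py z2 using K F1 z1 by algebra
  ultimately show ?thesis
    using dx dy unfolding A_def by (auto simp: real_differentiable_def)
qed

end
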